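(* For every fixed integer $k\ge 4$, $\Delta_k(n) \le \dfrac{k-2}{n} + o\!\left(\dfrac{1}{n}\right)$ as $n\to\infty$; that is, $\limsup_{n\to\infty} n\,\Delta_k(n)\le k-2$.
   Context: For an integer $k\ge 3$, an integer $n\ge k$ and a set $\mathcal{P}$ of $n$ points in the unit square $[0,1]^2$, let $\mathcal{A}_k(\mathcal{P})$ be the minimum, over all $k$-element subsets of $\mathcal{P}$, of the area of the convex hull of that subset. Define $\Delta_k(n)$ as the supremum of $\mathcal{A}_k(\mathcal{P})$ over all $n$-point sets $\mathcal{P}\subset[0,1]^2$. *)

theory Defs
  imports "HOL-Analysis.Analysis" "HOL-Library.Landau_Symbols"
begin

(* 1 :: real ^ 2 is the all-ones vector *)
definition unit_square :: "(real ^ 2) set" where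
  "unit_square = cbox 0 1"

lemma mem_unit_square: "p \<in> unit_square \<longleftrightarrow> (\<forall>i. 0 \<le> p $ i \<and> p $ i \<le> 1)"
  by (simp add: unit_square_def mem_box_cart)

(* The minimum is over a finite set; it is nonempty exactly when k \<le> card P. *)
definition min_hull_area :: "nat \<Rightarrow> (real ^ 2) set \<Rightarrow> real" where
  "min_hull_area k P =
     Min ((\<lambda>S. measure lborel (convex hull S)) ` {S. S \<subseteq> P \<and> card S = k})"

(* A supremum of reals: for n \<ge> k \<ge> 1 the family is nonempty and bounded by the
   area 1 of the square. For n < k the value is unspecified and never used. *)
definition heilbronn :: "nat \<Rightarrow> nat \<Rightarrow> real" where
  "heilbronn k n =
     (SUP P \<in> {P. P \<subseteq> unit_square \<and> finite P \<and> card P = n}. min_hull_area k P)"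

end

theory Submission
  imports Defs "HOL-Real_Asymp.Real_Asymp"
begin

text \<open>
  Sort the points by their first coordinate and look at all \<open>n - k + 1\<close> windows of \<open>k\<close> consecutive
  points. Within the slab between two consecutive abscissae the hull of a window has area at most the
  width of the slab, and at most half of it if the slab is the first or the last one of the window,
  since the hull is there contained in a triangle with its apex at the extreme point. Each slab
  is first in at most one window, last in at most one, and inner in at most \<open>k - 3\<close>, so that
  the areas of all windows add up to at most \<open>(k - 3) + 1/2 + 1/2 = k - 2\<close>.
\<close>

section \<open>Half-planes, triangles and rectangles\<close>

lemma convex_halfplane_le: "convex {q :: real ^ 2. a * q $ 1 + b * q $ 2 \<le> c}"
proof -
  have "{q :: real ^ 2. a * q $ 1 + b * q $ 2 \<le> c} = {q. vector [a, b] \<bullet> q \<le> c}"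
    by (simp add: inner_vec_def sum_2)
  then show ?thesis
    by (simp add: convex_halfspace_le)
qed

text \<open>At relative distance \<open>t\<close> from the apex \<open>p\<close>, the triangle's
  vertical slice has length \<open>t\<close> and starts at height \<open>(1 - t) * p $ 2\<close>.
  The height of \<open>q\<close> above that start is the barycentric weight of the top
  vertex.\<close>

lemma mem_convex_hull_vertical_triangle:
  fixes p q :: "real ^ 2"
  assumes "0 \<le> t" "t \<le> 1" "q $ 1 = (1 - t) * p $ 1 + t * u"
    and "(1 - t) * p $ 2 \<le> q $ 2" "q $ 2 \<le> (1 - t) * p $ 2 + t"
  shows "q \<in> convex hull {p, vector [u, 0], vector [u, 1]}"
proof -
  define b where "b = q $ 2 - (1 - t) * p $ 2"
  have "q = (1 - t) *\<^sub>R p + (t - b) *\<^sub>R vector [u, 0] + b *\<^sub>R vector [u, 1]"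
    using assms(3) by (simp add: vec_eq_iff forall_2 b_def algebra_simps)
  moreover have "0 \<le> 1 - t" "0 \<le> t - b" "0 \<le> b"
    using assms by (auto simp: b_def)
  ultimately show ?thesis
    unfolding convex_hull_3
    by (intro CollectI exI[of _ "1 - t"] exI[of _ "t - b"] exI[of _ b]) auto
qed

lemma measure_lborel_vertical_triangle:
  fixes p :: "real ^ 2"
  shows "measure lborel (convex hull {p, vector [u, 0], vector [u, 1]}) = \<bar>u - p $ 1\<bar> / 2"
  by (subst content_triangle) (simp add: algebra_simps)

lemma measure_lborel_rectangle:
  assumes "a \<le> (b :: real)"
  shows "measure lborel (cbox (vector [a, 0]) (vector [b, 1]) :: (real ^ 2) set) = b - a"
proof -
  have "cbox (vector [a, 0]) (vector [b, 1]) \<noteq> ({} :: (real ^ 2) set)"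
    using assms by (simp add: interval_ne_empty_cart forall_2)
  then show ?thesis
    by (simp add: content_cbox_cart prod_2 UNIV_2)
qed

section \<open>Area of the hull of one window\<close>

lemma convex_hull_linear_le:
  fixes q :: "real ^ 2"
  assumes "q \<in> convex hull W" "\<And>w. w \<in> W \<Longrightarrow> a * w $ 1 + b * w $ 2 \<le> c"
  shows "a * q $ 1 + b * q $ 2 \<le> c"
proof -
  have "convex hull W \<subseteq> {w. a * w $ 1 + b * w $ 2 \<le> c}"
    using assms(2) by (intro hull_minimal convex_halfplane_le) blast
  then show ?thesis using assms(1) by blast
qed

text \<open>The sign \<open>s = \<plusminus>1\<close> selects the side of \<open>p\<close> on which the other points lie.\<close>

lemma convex_hull_near_apex:
  fixes p q :: "real ^ 2"
  assumes W: "W \<subseteq> unit_square" "p \<in> W" "\<And>w. w \<in> W \<Longrightarrow> w \<noteq> p \<Longrightarrow> d \<le> s * (w $ 1 - p $ 1)"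
    and s: "s * s = 1" and d: "d > 0"
    and q: "q \<in> convex hull W" "0 \<le> s * (q $ 1 - p $ 1)" "s * (q $ 1 - p $ 1) \<le> d"
  shows "q \<in> convex hull {p, vector [p $ 1 + s * d, 0], vector [p $ 1 + s * d, 1]}"
proof -
  have sq: "0 \<le> w $ 2" "w $ 2 \<le> 1" if "w \<in> W" for w
    using that W(1) by (auto simp: mem_unit_square)
  note p = sq[OF W(2)]
  define t where "t = s * (q $ 1 - p $ 1) / d"
  have td: "t * d = s * (q $ 1 - p $ 1)" using d by (simp add: t_def)
  \<comment> \<open>The bounding line passes through \<open>p\<close> and
    \<open>vector [p $ 1 + s * d, 1]\<close>. Every other point of \<open>W\<close> has horizontal
    distance at least \<open>d\<close> from \<open>p\<close>, where this line has height at least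
    1.\<close>
  have up: "(- (1 - p $ 2) * s) * q $ 1 + d * q $ 2 \<le> d * p $ 2 - (1 - p $ 2) * s * p $ 1"
  proof (rule convex_hull_linear_le[OF q(1)])
    fix w assume w: "w \<in> W"
    show "(- (1 - p $ 2) * s) * w $ 1 + d * w $ 2 \<le> d * p $ 2 - (1 - p $ 2) * s * p $ 1"
    proof (cases "w = p")
      case False
      then have "(1 - p $ 2) * d \<le> (1 - p $ 2) * (s * (w $ 1 - p $ 1))" "d * w $ 2 \<le> d * 1"
        using W(3)[OF w] sq[OF w] p d by (auto intro!: mult_left_mono)
      then show ?thesis by (simp add: algebra_simps)
    qed (simp add: algebra_simps)
  qed
  \<comment> \<open>Likewise for the line through \<open>p\<close> and
    \<open>vector [p $ 1 + s * d, 0]\<close>, whose height is at most 0 from distance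
    \<open>d\<close> on.\<close>
  have down: "(- p $ 2 * s) * q $ 1 + (- d) * q $ 2 \<le> - d * p $ 2 - p $ 2 * s * p $ 1"
  proof (rule convex_hull_linear_le[OF q(1)])
    fix w assume w: "w \<in> W"
    show "(- p $ 2 * s) * w $ 1 + (- d) * w $ 2 \<le> - d * p $ 2 - p $ 2 * s * p $ 1"
    proof (cases "w = p")
      case False
      then have "p $ 2 * d \<le> p $ 2 * (s * (w $ 1 - p $ 1))" "0 \<le> d * w $ 2"
        using W(3)[OF w] sq[OF w] p d by (auto intro!: mult_left_mono)
      then show ?thesis by (simp add: algebra_simps)
    qed (simp add: algebra_simps)
  qed
  show ?thesis
  proof (rule mem_convex_hull_vertical_triangle)
    show "0 \<le> t" "t \<le> 1" using q d by (auto simp: t_def)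
    have "s * (t * d) = q $ 1 - p $ 1"
      unfolding td using s by (simp flip: mult.assoc)
    then show "q $ 1 = (1 - t) * p $ 1 + t * (p $ 1 + s * d)"
      by (simp add: algebra_simps)
    have "d * ((1 - t) * p $ 2) = d * p $ 2 - (t * d) * p $ 2" by (simp add: algebra_simps)
    also have "\<dots> \<le> d * q $ 2" using down unfolding td by (simp add: algebra_simps)
    finally show "(1 - t) * p $ 2 \<le> q $ 2" using d by simp
    have "d * q $ 2 \<le> d * p $ 2 - (t * d) * p $ 2 + t * d"
      using up unfolding td by (simp add: algebra_simps)
    also have "\<dots> = d * ((1 - t) * p $ 2 + t)" by (simp add: algebra_simps)
    finally show "q $ 2 \<le> (1 - t) * p $ 2 + t" using d by simp
  qed
qed

lemma convex_hull_strip_subset: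
  fixes l r :: "real ^ 2"
  assumes "l \<in> unit_square" "r \<in> unit_square" and order: "l $ 1 \<le> u" "u \<le> v" "v \<le> r $ 1"
    and M: "M \<subseteq> unit_square" "\<And>q. q \<in> M \<Longrightarrow> u \<le> q $ 1 \<and> q $ 1 \<le> v"
  shows "convex hull (insert l (insert r M)) \<subseteq>
           convex hull {l, vector [u, 0], vector [u, 1]} \<union>
           cbox (vector [u, 0]) (vector [v, 1]) \<union>
           convex hull {r, vector [v, 0], vector [v, 1]}" (is "?H \<subseteq> ?T1 \<union> ?R \<union> ?T2")
proof
  let ?W = "insert l (insert r M)"
  fix q assume q: "q \<in> ?H"
  have sq: "?W \<subseteq> unit_square" using assms by auto
  have W: "0 \<le> w $ 2" "w $ 2 \<le> 1" "l $ 1 \<le> w $ 1" "w $ 1 \<le> r $ 1" if "w \<in> ?W" for w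
    using that order M(2)[of w] sq by (auto simp: mem_unit_square)
  have q2: "0 \<le> q $ 2" "q $ 2 \<le> 1" and q1: "l $ 1 \<le> q $ 1" "q $ 1 \<le> r $ 1"
    using convex_hull_linear_le[OF q, of 0 "-1" 0] convex_hull_linear_le[OF q, of 0 1 1]
      convex_hull_linear_le[OF q, of "-1" 0 "- l $ 1"] convex_hull_linear_le[OF q, of 1 0 "r $ 1"] W
    by auto
  consider "q $ 1 < u" | "u \<le> q $ 1" "q $ 1 \<le> v" | "v < q $ 1" by linarith
  then show "q \<in> ?T1 \<union> ?R \<union> ?T2"
  proof cases
    \<comment> \<open>With \<open>l $ 1 \<le> q $ 1\<close> this gives \<open>u - l $ 1 > 0\<close>,
      the positive distance to the apex \<open>l\<close>. If \<open>l $ 1 = u\<close>, the case is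
      vacuous.\<close>
    case 1
    have "q \<in> convex hull {l, vector [l $ 1 + 1 * (u - l $ 1), 0], vector [l $ 1 + 1 * (u - l $ 1), 1]}"
      using 1 q1 order M(2) q by (intro convex_hull_near_apex[OF sq]) force+
    then show ?thesis by simp
  next
    case 2
    then have "q \<in> ?R" using q2 by (simp add: mem_box_cart forall_2)
    then show ?thesis by blast
  next
    \<comment> \<open>The mirror image: apex \<open>r\<close>, with sign \<open>-1\<close> since the
      other points lie to its left.\<close>
    case 3
    have "q \<in> convex hull {r, vector [r $ 1 + (- 1) * (r $ 1 - v), 0],
        vector [r $ 1 + (- 1) * (r $ 1 - v), 1]}"
      using 3 q1 order M(2) q by (intro convex_hull_near_apex[OF sq]) force+
    then show ?thesis by simp
  qed
qed

text \<open>The two triangles count half their widths and the rectangle its full width. The total is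
  written as the mean of the outer and the inner width because each of these telescopes when summed
  over windows.\<close>

lemma measure_lborel_convex_hull_strip_le:
  fixes l r :: "real ^ 2"
  assumes "l \<in> unit_square" "r \<in> unit_square" and order: "l $ 1 \<le> u" "u \<le> v" "v \<le> r $ 1"
    and M: "finite M" "M \<subseteq> unit_square" "\<And>q. q \<in> M \<Longrightarrow> u \<le> q $ 1 \<and> q $ 1 \<le> v"
  shows "measure lborel (convex hull (insert l (insert r M))) \<le> ((r $ 1 - l $ 1) + (v - u)) / 2"
proof -
  let ?T1 = "convex hull {l, vector [u, 0], vector [u, 1]}"
  let ?T2 = "convex hull {r, vector [v, 0], vector [v, 1]}"
  let ?R = "cbox (vector [u, 0]) (vector [v, 1]) :: (real ^ 2) set"
  have compact: "compact ?T1" "compact ?T2" "compact (convex hull (insert l (insert r M)))"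
    using M(1) by (auto intro!: finite_imp_compact_convex_hull)
  have fm: "?T1 \<in> fmeasurable lborel" "?T2 \<in> fmeasurable lborel" "?R \<in> fmeasurable lborel"
    using compact by (auto intro!: fmeasurable_compact)
  have "measure lborel (convex hull (insert l (insert r M))) \<le> measure lborel (?T1 \<union> ?R \<union> ?T2)"
    using convex_hull_strip_subset[OF assms(1-5) M(2,3)] compact(3) fm
    by (intro measure_mono_fmeasurable) (auto intro!: borel_compact)
  also have "\<dots> \<le> measure lborel (?T1 \<union> ?R) + measure lborel ?T2"
    using fm by (intro measure_Un_le) auto
  also have "\<dots> \<le> measure lborel ?T1 + measure lborel ?R + measure lborel ?T2"
    using fm by (intro add_right_mono measure_Un_le) auto
  also have "\<dots> = ((r $ 1 - l $ 1) + (v - u)) / 2"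
    using order by (simp add: measure_lborel_vertical_triangle measure_lborel_rectangle field_simps)
  finally show ?thesis .
qed

section \<open>Telescoping sums\<close>

text \<open>Both sides equal the sum of \<open>f\<close> below \<open>m + r\<close> minus its sums
  below \<open>m\<close> and below \<open>r\<close>. This trades \<open>m\<close> terms for
  \<open>r\<close> terms, so a bound on \<open>f\<close> yields one independent of
  \<open>m\<close>.\<close>

lemma sum_shift_diff:
  fixes f :: "nat \<Rightarrow> 'a :: ab_group_add"
  shows "(\<Sum>i<m. f (i + r) - f i) = (\<Sum>j<r. f (m + j) - f j)"
proof (induction m)
  case (Suc m)
  have "(\<Sum>j<r. f (Suc (m + j)) - f (m + j)) = f (m + r) - f m"
    using sum_lessThan_telescope[of "\<lambda>j. f (m + j)" r] by simp
  moreover have "(\<Sum>j<r. f (Suc m + j) - f j) =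
      (\<Sum>j<r. f (Suc (m + j)) - f (m + j)) + (\<Sum>j<r. f (m + j) - f j)"
    by (simp flip: sum.distrib)
  ultimately show ?case using Suc by simp
qed simp

lemma sum_shift_diff_le:
  fixes f :: "nat \<Rightarrow> real"
  assumes "\<And>i. i < m + r \<Longrightarrow> 0 \<le> f i \<and> f i \<le> 1"
  shows "(\<Sum>i<m. f (i + r) - f i) \<le> r"
proof -
  have "(\<Sum>j<r. f (m + j) - f j) \<le> (\<Sum>j<r. 1)"
    using assms by (intro sum_mono) (smt (verit) add_less_cancel_left lessThan_iff trans_less_add2)
  then show ?thesis by (simp add: sum_shift_diff)
qed

section \<open>Averaging over the windows\<close>

lemma min_hull_area_le:
  assumes k: "3 \<le> k" and P: "P \<subseteq> unit_square" "finite P" "k \<le> card P"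
  shows "min_hull_area k P \<le> (real k - 2) / (real (card P) + 1 - real k)"
proof -
  define n where "n = card P"
  \<comment> \<open>The number of start indices \<open>i\<close> with
    \<open>i + k \<le> n\<close>.\<close>
  define m where "m = n + 1 - k"
  obtain xs0 where xs0: "set xs0 = P" "distinct xs0"
    using finite_distinct_list[OF P(2)] by blast
  define xs where "xs = sort_key (\<lambda>p. p $ 1) xs0"
  have xs: "set xs = P" "distinct xs" "length xs = n" "sorted (map (\<lambda>p. p $ 1) xs)"
    using xs0 by (auto simp: xs_def n_def distinct_card[symmetric])
  define x where "x i = xs ! i $ 1" for i
  have x_mono: "x i \<le> x j" if "i \<le> j" "j < n" for i j
    using sorted_nth_mono[OF xs(4), of i j] that xs(3) by (simp add: x_def)
  have in_P: "xs ! i \<in> P" if "i < n" for i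
    using that xs by auto
  then have sq: "xs ! i \<in> unit_square" if "i < n" for i
    using that P by auto
  have x01: "0 \<le> x i \<and> x i \<le> 1" if "i < n" for i
    using sq[OF that] by (simp add: mem_unit_square x_def)
  let ?A = "min_hull_area k P"
  \<comment> \<open>The inner points have indices from \<open>Suc i\<close> to
    \<open>i + k - 2\<close>. Writing the latter as \<open>Suc i + (k - 3)\<close> makes both widths
    differences under a constant shift.\<close>
  have window: "?A \<le> ((x (i + (k - 1)) - x i) + (x (Suc i + (k - 3)) - x (Suc i))) / 2"
    if i: "i < m" for i
  proof -
    let ?S = "(!) xs ` {i..<i + k}"
    let ?M = "(!) xs ` {Suc i..<i + (k - 1)}"
    have ik: "i + k \<le> n" using i by (simp add: m_def)
    have "{i..<i + k} = insert i (insert (i + (k - 1)) {Suc i..<i + (k - 1)})"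
      using k by auto
    then have S: "?S = insert (xs ! i) (insert (xs ! (i + (k - 1))) ?M)" by (simp only: image_insert)
    \<comment> \<open>Abscissae may coincide; distinctness of the list still gives \<open>k\<close>
      different points.\<close>
    have "inj_on ((!) xs) {i..<i + k}"
      using xs ik by (auto simp: inj_on_def nth_eq_iff_index_eq)
    then have "card ?S = k" by (simp add: card_image)
    moreover have "?S \<subseteq> P" using in_P ik by auto
    ultimately have "?A \<le> measure lborel (convex hull ?S)"
      unfolding min_hull_area_def using P(2)
      by (intro Min_le finite_imageI finite_subset[OF _ finite_Pow_iff[THEN iffD2, OF P(2)]]) auto
    also have "\<dots> \<le> ((xs ! (i + (k - 1)) $ 1 - xs ! i $ 1) + (x (Suc i + (k - 3)) - x (Suc i))) / 2"
      unfolding S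
    proof (rule measure_lborel_convex_hull_strip_le)
      show "xs ! i $ 1 \<le> x (Suc i)" "x (Suc i) \<le> x (Suc i + (k - 3))"
        "x (Suc i + (k - 3)) \<le> xs ! (i + (k - 1)) $ 1"
        unfolding x_def[symmetric] using k ik by (auto intro!: x_mono)
      show "x (Suc i) \<le> q $ 1 \<and> q $ 1 \<le> x (Suc i + (k - 3))" if "q \<in> ?M" for q
        using that k ik by (auto simp flip: x_def intro!: x_mono)
    qed (use sq ik k in auto)
    finally show ?thesis by (simp add: x_def)
  qed
  have m: "m > 0" "real m = real n + 1 - real k"
    using P k by (auto simp: m_def n_def)
  \<comment> \<open>These identities keep all indices in both sums below \<open>n\<close>, where
    \<open>x\<close> lies between 0 and 1.\<close>
  have mk: "m + (k - 1) = n" "m + (k - 3) + 2 = n"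
    using P k by (auto simp: m_def n_def)
  have "real m * ?A = (\<Sum>i<m. ?A)" by simp
  also have "\<dots> \<le> (\<Sum>i<m. ((x (i + (k - 1)) - x i) + (x (Suc i + (k - 3)) - x (Suc i))) / 2)"
    by (intro sum_mono window) simp
  also have "\<dots> = ((\<Sum>i<m. x (i + (k - 1)) - x i) + (\<Sum>i<m. x (Suc (i + (k - 3))) - x (Suc i))) / 2"
    by (simp add: sum.distrib flip: sum_divide_distrib)
  also have "\<dots> \<le> (real (k - 1) + real (k - 3)) / 2"
    using mk by (intro divide_right_mono add_mono sum_shift_diff_le[of m "k - 3" "\<lambda>i. x (Suc i)"]
        sum_shift_diff_le x01) auto
  also have "\<dots> = real k - 2" using k by (simp add: of_nat_diff)
  finally show ?thesis using m by (simp add: pos_le_divide_eq mult.commute flip: n_def)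
qed

section \<open>Supremum and asymptotics\<close>

text \<open>Guarantees \<open>n\<close>-point sets for every \<open>n\<close>, so that the supremum
  in \<open>heilbronn\<close> ranges over a nonempty family.\<close>

lemma infinite_unit_square: "infinite unit_square"
proof -
  have "axis 1 ` {0..1 :: real} \<subseteq> unit_square"
    by (auto simp: mem_unit_square axis_def)
  moreover have "infinite (axis 1 ` {0..1 :: real} :: (real ^ 2) set)"
    by (subst finite_image_iff) (auto simp: inj_on_def axis_eq_axis infinite_Icc)
  ultimately show ?thesis using finite_subset by blast
qed

lemma heilbronn_le:
  assumes "3 \<le> k" "k \<le> n"
  shows "heilbronn k n \<le> (real k - 2) / (real n + 1 - real k)"
proof -
  have "\<exists>P. P \<subseteq> unit_square \<and> finite P \<and> card P = n"
    using infinite_arbitrarily_large[OF infinite_unit_square] by blast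
  then show ?thesis
    unfolding heilbronn_def using assms min_hull_area_le[of k]
    by (intro cSUP_least) auto
qed

theorem theorem2:
  fixes k :: nat
  assumes "k \<ge> 4"
  shows "(\<exists>r \<in> o(\<lambda>n. 1 / real n).
            \<forall>n\<ge>k. heilbronn k n \<le> (real k - 2) / real n + r n)
       \<and> limsup (\<lambda>n. ereal (real n * heilbronn k n)) \<le> ereal (real k - 2)"
proof
  \<comment> \<open>The exact excess of the bound over the main term; it equals
    \<open>(k - 2) * (k - 1) / (n * (n + 1 - k))\<close>, of order \<open>1 / n^2\<close>.\<close>
  let ?r = "\<lambda>n. (real k - 2) / (real n + 1 - real k) - (real k - 2) / real n"
  have "?r \<in> o(\<lambda>n. 1 / real n)" by real_asymp
  then show "\<exists>r \<in> o(\<lambda>n. 1 / real n). \<forall>n\<ge>k. heilbronn k n \<le> (real k - 2) / real n + r n"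
    using heilbronn_le[of k] assms by (intro bexI[of _ ?r]) auto
next
  let ?b = "\<lambda>n. real n * ((real k - 2) / (real n + 1 - real k))"
  have "?b \<longlonglongrightarrow> real k - 2" by real_asymp
  then have "limsup (\<lambda>n. ereal (?b n)) = ereal (real k - 2)"
    by (intro lim_imp_Limsup) (auto simp: tendsto_ereal)
  \<comment> \<open>The comparison holds from \<open>n = k\<close> on, which suffices for the
    limsup.\<close>
  moreover have "limsup (\<lambda>n. ereal (real n * heilbronn k n)) \<le> limsup (\<lambda>n. ereal (?b n))"
    using heilbronn_le[of k] assms
    by (intro Limsup_mono eventually_sequentiallyI[of k])
       (simp add: mult_left_mono del: times_divide_eq_right)
  ultimately show "limsup (\<lambda>n. ereal (real n * heilbronn k n)) \<le> ereal (real k - 2)"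
    by simp
qed

end
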